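(* For every $n\ge 3$, there exists an isometric point-circle configuration of type $\left(\binom{2n-1}{n-1}_n\right)$. It is (isomorphic to) a subconfiguration of the Clifford configuration of type $\left(2^{2n-2}_{2n-1}\right)$, and it is the incidence structure obtained from the odd graph $O_n$ by $V$-construction.
   Context: The Kneser graph $K(m,k)$ has as vertices the $k$-subsets of an $m$-element set, two adjacent iff disjoint; the odd graph is $O_n=K(2n-1,n-1)$. The $V$-construction of a graph $G$ is the incidence structure $N(G)$ with points $V(G)$, blocks $\{N(v)\mid v\in V(G)\}$ where $N(v)$ is the neighbourhood of $v$, incidence being membership. An $(m_k)$ configuration is an incidence structure with $m$ points and $m$ blocks, each block incident with $k$ points and each point with $k$ blocks. The Clifford configuration of type $(2^{d-1}_d)$ has as points the vectors of $\{0,1\}^d$ with an even number of 1's, as blocks those with an odd number of 1's, incident iff they differ in exactly one coordinate; a subconfiguration is obtained by taking a subset of the points and a subset of the blocks with the induced incidence. An isometric point-circle configuration is a realization in the plane by distinct points and distinct circles of a common radius, each point lying on the circles of the blocks incident with it. *)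

theory Defs
  imports "HOL-Analysis.Analysis" "Graph_Theory.Pair_Digraph"
begin

section \<open>Kneser graphs and odd graphs\<close>

text \<open>A simple graph is a \<open>pair_graph\<close>: a finite, symmetric, loop-free set of ordered pairs.\<close>

definition kneser_graph :: "nat \<Rightarrow> nat \<Rightarrow> nat set pair_pre_digraph" where
  "kneser_graph m k =
    (let V = {A. A \<subseteq> {..<m} \<and> card A = k}
     in \<lparr> pverts = V, parcs = {(A, B). A \<in> V \<and> B \<in> V \<and> A \<inter> B = {}} \<rparr>)"

text \<open>For \<open>k = 0\<close> the empty set is disjoint from itself, which would be a loop.\<close>

lemma pair_graph_kneser_graph:
  assumes "0 < k"
  shows "pair_graph (kneser_graph m k)"
proof -
  let ?V = "{A. A \<subseteq> {..<m} \<and> card A = k}"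
  have fin: "finite ?V"
    by (rule finite_subset[of _ "Pow {..<m}"]) auto
  have verts: "pverts (kneser_graph m k) = ?V"
    and arcs: "parcs (kneser_graph m k) = {(A, B). A \<in> ?V \<and> B \<in> ?V \<and> A \<inter> B = {}}"
    by (simp_all add: kneser_graph_def)
  have "parcs (kneser_graph m k) \<subseteq> ?V \<times> ?V"
    unfolding arcs by blast
  then have fin_arcs: "finite (parcs (kneser_graph m k))"
    using fin finite_subset by blast
  have sym: "sym (parcs (kneser_graph m k))"
    unfolding arcs sym_def by blast
  show ?thesis
  proof
    fix e assume e: "e \<in> parcs (kneser_graph m k)"
    show "fst e \<in> pverts (kneser_graph m k)" "snd e \<in> pverts (kneser_graph m k)"
      using e unfolding arcs verts by (simp_all add: case_prod_beta)
    have "card (fst e) = k" "fst e \<inter> snd e = {}"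
      using e unfolding arcs by (simp_all add: case_prod_beta)
    then show "fst e \<noteq> snd e"
      using assms by fastforce
  next
    show "finite (pverts (kneser_graph m k))" unfolding verts by (fact fin)
    show "finite (parcs (kneser_graph m k))" by (fact fin_arcs)
    show "symmetric (with_proj (kneser_graph m k))"
      using sym by (simp add: symmetric_def)
  qed
qed

definition odd_graph :: "nat \<Rightarrow> nat set pair_pre_digraph" where
  "odd_graph n = kneser_graph (2 * n - 1) (n - 1)"

definition neighbourhood :: "'a pair_pre_digraph \<Rightarrow> 'a \<Rightarrow> 'a set" where
  "neighbourhood G v = {u. (v, u) \<in> parcs G}"

section \<open>Incidence structures and configurations\<close>

record ('p, 'b) incidence_structure =
  points :: "'p set"
  blocks :: "'b set"
  incidence :: "('p \<times> 'b) set"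

definition is_incidence_structure :: "('p, 'b) incidence_structure \<Rightarrow> bool" where
  "is_incidence_structure I \<longleftrightarrow> incidence I \<subseteq> points I \<times> blocks I"

text \<open>\<open>configuration_of_type I m k\<close>: \<open>I\<close> is an $(m_k)$ configuration.\<close>

definition configuration_of_type :: "('p, 'b) incidence_structure \<Rightarrow> nat \<Rightarrow> nat \<Rightarrow> bool" where
  "configuration_of_type I m k \<longleftrightarrow>
    is_incidence_structure I \<and>
    finite (points I) \<and> card (points I) = m \<and>
    finite (blocks I) \<and> card (blocks I) = m \<and>
    (\<forall>b\<in>blocks I. card {p \<in> points I. (p, b) \<in> incidence I} = k) \<and>
    (\<forall>p\<in>points I. card {b \<in> blocks I. (p, b) \<in> incidence I} = k)"

definition subconfiguration ::
  "('p, 'b) incidence_structure \<Rightarrow> ('p, 'b) incidence_structure \<Rightarrow> bool" where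
  "subconfiguration S I \<longleftrightarrow>
    points S \<subseteq> points I \<and> blocks S \<subseteq> blocks I \<and>
    incidence S = incidence I \<inter> (points S \<times> blocks S)"

definition isomorphic_incidence_structures ::
  "('p, 'b) incidence_structure \<Rightarrow> ('q, 'c) incidence_structure \<Rightarrow> bool" where
  "isomorphic_incidence_structures I J \<longleftrightarrow>
    (\<exists>f g. bij_betw f (points I) (points J) \<and> bij_betw g (blocks I) (blocks J) \<and>
      (\<forall>p\<in>points I. \<forall>b\<in>blocks I. (p, b) \<in> incidence I \<longleftrightarrow> (f p, g b) \<in> incidence J))"

definition V_construction :: "'a pair_pre_digraph \<Rightarrow> ('a, 'a set) incidence_structure" where
  "V_construction G =
    \<lparr> points = pverts G,
      blocks = neighbourhood G ` pverts G,
      incidence = {(p, B). p \<in> pverts G \<and> B \<in> neighbourhood G ` pverts G \<and> p \<in> B} \<rparr>"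

section \<open>Clifford configurations\<close>

text \<open>A vector of $\{0,1\}^d$ is a function on \<open>{..<d}\<close>, extended by \<open>undefined\<close> outside.\<close>

definition binary_vectors :: "nat \<Rightarrow> (nat \<Rightarrow> nat) set" where
  "binary_vectors d = ({..<d} \<rightarrow>\<^sub>E {0, 1})"

definition clifford_configuration :: "nat \<Rightarrow> (nat \<Rightarrow> nat, nat \<Rightarrow> nat) incidence_structure" where
  "clifford_configuration d =
    (let P = {x \<in> binary_vectors d. even (card {i \<in> {..<d}. x i = 1})};
         B = {y \<in> binary_vectors d. odd (card {i \<in> {..<d}. y i = 1})}
     in \<lparr> points = P,
          blocks = B,
          incidence = {(x, y). x \<in> P \<and> y \<in> B \<and> card {i \<in> {..<d}. x i \<noteq> y i} = 1} \<rparr>)"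

section \<open>Isometric point-circle realizations\<close>

text \<open>
  Points are sent to distinct points of the plane and blocks to distinct circles of a common
  radius. Incidence is preserved, but a point may also lie on the circle of a block it is not
  incident with.
\<close>

definition isometric_point_circle_realization ::
  "('p, 'b) incidence_structure \<Rightarrow> ('p \<Rightarrow> real ^ 2) \<Rightarrow> ('b \<Rightarrow> (real ^ 2) set) \<Rightarrow> bool" where
  "isometric_point_circle_realization I pt circ \<longleftrightarrow>
    inj_on pt (points I) \<and> inj_on circ (blocks I) \<and>
    (\<exists>r>0. \<forall>b\<in>blocks I. \<exists>c. circ b = sphere c r) \<and>
    (\<forall>p\<in>points I. \<forall>b\<in>blocks I. (p, b) \<in> incidence I \<longrightarrow> pt p \<in> circ b)"

definition isometric_point_circle_configuration :: "('p, 'b) incidence_structure \<Rightarrow> bool" where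
  "isometric_point_circle_configuration I \<longleftrightarrow>
    (\<exists>pt circ. isometric_point_circle_realization I pt circ)"

end

theory Submission
  imports Defs "HOL-Library.Nat_Bijection"
begin

text \<open>
  Choose unit vectors \<open>u\<^sub>i\<close> in the plane whose subset sums are pairwise distinct. Sending an
  \<open>(n - 1)\<close>-set \<open>p\<close> to the sum of its vectors, and the block \<open>N(v)\<close> to the unit circle whose centre
  is the sum over the complement of \<open>v\<close>, gives the realization: if \<open>p\<close> is disjoint from \<open>v\<close>,
  the complement of \<open>v\<close> is \<open>p\<close> together with one further element \<open>i\<close>, so centre and point
  differ by \<open>u\<^sub>i\<close>. The same picture in the hypercube, with sets replaced by their
  indicator vectors, gives the embedding into the Clifford configuration, after complementing
  all sets when \<open>n - 1\<close> is odd.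
\<close>

section \<open>Finite sets, circles and unit vectors\<close>

lemma Union_subsets_of_card:
  assumes "finite B" "0 < k" "k \<le> card B"
  shows "\<Union>{A. A \<subseteq> B \<and> card A = k} = B"
proof
  show "B \<subseteq> \<Union>{A. A \<subseteq> B \<and> card A = k}"
  proof
    fix x assume x: "x \<in> B"
    have "k - 1 \<le> card (B - {x})"
      using assms x by simp
    then obtain T where T: "T \<subseteq> B - {x}" "card T = k - 1" "finite T"
      by (rule obtain_subset_with_card_n)
    have "card (insert x T) = k"
      using T assms by (subst card_insert_disjoint) auto
    then show "x \<in> \<Union>{A. A \<subseteq> B \<and> card A = k}"
      using T x by blast
  qed
qed auto

text \<open>As \<open>Y\<close> has one element more than \<open>X\<close>, the symmetric difference
  has size 2 * |X - Y| + 1. This turns "differing in exactly one coordinate" into inclusion.\<close>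

lemma card_symdiff_eq_1_iff:
  assumes "finite X" "finite Y" "card Y = Suc (card X)"
  shows "card ((X - Y) \<union> (Y - X)) = 1 \<longleftrightarrow> X \<subseteq> Y"
proof -
  have "card X = card (X \<inter> Y) + card (X - Y)" "card Y = card (Y \<inter> X) + card (Y - X)"
    using assms card_Int_Diff by blast+
  then have "card (Y - X) = Suc (card (X - Y))"
    using assms by (simp add: Int_commute)
  moreover have "card ((X - Y) \<union> (Y - X)) = card (X - Y) + card (Y - X)"
    using assms by (intro card_Un_disjoint) auto
  ultimately have "card ((X - Y) \<union> (Y - X)) = 1 \<longleftrightarrow> card (X - Y) = 0"
    by linarith
  then show ?thesis
    using assms by auto
qed

text \<open>If the centres differed, the point of the sphere around \<open>a\<close> farthest from
  \<open>b\<close>, on the ray from \<open>b\<close> through \<open>a\<close>, would have distance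
  |a - b| + r > r from \<open>b\<close>.\<close>

lemma sphere_eq_sphereD:
  fixes a b :: "'a::euclidean_space"
  assumes "sphere a r = sphere b r" "0 < r"
  shows "a = b"
proof (rule ccontr)
  assume "a \<noteq> b"
  define w where "w = (r / norm (a - b)) *\<^sub>R (a - b)"
  have "norm w = r"
    using \<open>a \<noteq> b\<close> assms by (simp add: w_def)
  then have "a + w \<in> sphere b r"
    unfolding assms(1)[symmetric] by (simp add: dist_norm)
  moreover have "a + w - b = (1 + r / norm (a - b)) *\<^sub>R (a - b)"
    by (simp add: w_def algebra_simps)
  ultimately have "norm ((1 + r / norm (a - b)) *\<^sub>R (a - b)) = r"
    by (simp add: dist_norm norm_minus_commute[of b])
  then have "(1 + r / norm (a - b)) * norm (a - b) = r"
    using assms(2) by simp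
  then show False
    using \<open>a \<noteq> b\<close> by (simp add: field_simps)
qed

lemma exists_unit_vectors_distinct_subset_sums:
  fixes m :: nat
  obtains u :: "nat \<Rightarrow> real ^ 2"
  where "\<And>i. i < m \<Longrightarrow> norm (u i) = 1" and "inj_on (\<lambda>X. \<Sum>i\<in>X. u i) (Pow {..<m})"
proof
  \<comment> \<open>First coordinates proportional to powers of two make a subset sum reveal its
    index set in binary. The scaling by \<open>2 ^ m\<close> keeps them below 1 for
    \<open>i < m\<close>, so that the second coordinate can complete a unit vector.\<close>
  define c :: "nat \<Rightarrow> real" where "c i = 2 ^ i / 2 ^ m" for i
  define u :: "nat \<Rightarrow> real ^ 2" where "u i = vector [c i, sqrt (1 - (c i)\<^sup>2)]" for i
  show "norm (u i) = 1" if "i < m" for i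
  proof -
    have "0 \<le> c i" "c i \<le> 1"
      using that by (simp_all add: c_def)
    then have "(c i)\<^sup>2 \<le> 1"
      by (simp add: power_le_one)
    then show ?thesis
      by (simp add: norm_eq_sqrt_inner inner_vec_def sum_2 u_def flip: power2_eq_square)
  qed
  have fst_sum: "(\<Sum>i\<in>X. u i) $ 1 = real (set_encode X) / 2 ^ m" for X
    by (simp add: u_def c_def set_encode_def sum_divide_distrib)
  show "inj_on (\<lambda>X. \<Sum>i\<in>X. u i) (Pow {..<m})"
  proof (rule inj_onI)
    fix X Y assume XY: "X \<in> Pow {..<m}" "Y \<in> Pow {..<m}" "(\<Sum>i\<in>X. u i) = (\<Sum>i\<in>Y. u i)"
    then have "set_encode X = set_encode Y"
      using fst_sum[of X] fst_sum[of Y] by simp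
    moreover have "finite X" "finite Y"
      using XY finite_subset by auto
    ultimately show "X = Y"
      by (simp add: set_encode_eq)
  qed
qed

section \<open>The V-construction of a Kneser graph\<close>

lemma mem_pverts_kneser: "A \<in> pverts (kneser_graph m k) \<longleftrightarrow> A \<subseteq> {..<m} \<and> card A = k"
  by (simp add: kneser_graph_def)

lemma card_complement_kneser:
  assumes "v \<in> pverts (kneser_graph m k)"
  shows "card ({..<m} - v) = m - k"
  using assms by (subst card_Diff_subset) (auto simp: mem_pverts_kneser finite_subset)

lemma neighbourhood_kneser:
  assumes "v \<in> pverts (kneser_graph m k)"
  shows "neighbourhood (kneser_graph m k) v = {A. A \<subseteq> {..<m} - v \<and> card A = k}"
  using assms by (auto simp: neighbourhood_def kneser_graph_def)

text \<open>At least \<open>k\<close> elements lie outside \<open>v\<close>, so each of them belongs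
  to some neighbour. The complement of \<open>v\<close> can thus be read off from the block
  alone.\<close>

lemma Union_neighbourhood_kneser:
  assumes "0 < k" "2 * k \<le> m" "v \<in> pverts (kneser_graph m k)"
  shows "\<Union>(neighbourhood (kneser_graph m k) v) = {..<m} - v"
  unfolding neighbourhood_kneser[OF assms(3)]
  using assms by (intro Union_subsets_of_card) (simp_all add: card_complement_kneser)

lemma inj_on_neighbourhood_kneser:
  assumes "0 < k" "2 * k \<le> m"
  shows "inj_on (neighbourhood (kneser_graph m k)) (pverts (kneser_graph m k))"
proof (rule inj_onI)
  fix v w assume vw: "v \<in> pverts (kneser_graph m k)" "w \<in> pverts (kneser_graph m k)"
    "neighbourhood (kneser_graph m k) v = neighbourhood (kneser_graph m k) w"
  then have "{..<m} - v = {..<m} - w"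
    using Union_neighbourhood_kneser[OF assms] by metis
  then show "v = w"
    using vw by (auto simp: mem_pverts_kneser)
qed

lemma Union_block_kneser_subset:
  assumes "b \<in> neighbourhood (kneser_graph m k) ` pverts (kneser_graph m k)"
  shows "\<Union>b \<subseteq> {..<m}"
  using assms by (auto simp: neighbourhood_kneser)

text \<open>A block consists of all \<open>k\<close>-subsets of its union and so is recovered from
  it. Maps on blocks can therefore be defined, and shown injective, through the union.\<close>

lemma inj_on_Union_blocks_kneser:
  assumes "0 < k" "2 * k \<le> m"
  shows "inj_on Union (neighbourhood (kneser_graph m k) ` pverts (kneser_graph m k))"
proof (rule inj_onI)
  let ?N = "neighbourhood (kneser_graph m k)"
  fix b c assume b: "b \<in> ?N ` pverts (kneser_graph m k)"
    and c: "c \<in> ?N ` pverts (kneser_graph m k)" and eq: "\<Union>b = \<Union>c"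
  have "b' = {A. A \<subseteq> \<Union>b' \<and> card A = k}" if b': "b' \<in> ?N ` pverts (kneser_graph m k)" for b'
  proof -
    obtain v where v: "v \<in> pverts (kneser_graph m k)" "b' = ?N v"
      using b' by blast
    show ?thesis
      unfolding v(2) Union_neighbourhood_kneser[OF assms v(1)]
      by (rule neighbourhood_kneser[OF v(1)])
  qed
  from this[OF b] this[OF c] show "b = c"
    unfolding eq by (rule trans[OF _ sym])
qed

lemma configuration_V_construction_kneser:
  assumes "0 < k" "2 * k \<le> m"
  shows "configuration_of_type (V_construction (kneser_graph m k)) (m choose k) ((m - k) choose k)"
proof -
  let ?G = "kneser_graph m k"
  let ?N = "neighbourhood ?G"
  have verts: "pverts ?G = {A. A \<subseteq> {..<m} \<and> card A = k}"
    by (auto simp: mem_pverts_kneser)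
  have fin: "finite (pverts ?G)"
    unfolding verts by (rule finite_subset[of _ "Pow {..<m}"]) auto
  have card_verts: "card (pverts ?G) = m choose k"
    unfolding verts by (subst n_subsets) auto
  have card_nbhd: "card {A. A \<subseteq> {..<m} - v \<and> card A = k} = (m - k) choose k"
    if "v \<in> pverts ?G" for v
    using that by (subst n_subsets) (auto simp: card_complement_kneser)
  have "card {p \<in> pverts ?G. p \<in> ?N v} = (m - k) choose k" if v: "v \<in> pverts ?G" for v
  proof -
    have "{p \<in> pverts ?G. p \<in> ?N v} = {A. A \<subseteq> {..<m} - v \<and> card A = k}"
      using v by (auto simp: neighbourhood_kneser mem_pverts_kneser)
    then show ?thesis
      using card_nbhd[OF v] by simp
  qed
  moreover have "card {b \<in> ?N ` pverts ?G. p \<in> b} = (m - k) choose k"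
    if p: "p \<in> pverts ?G" for p
  proof -
    \<comment> \<open>Disjointness is symmetric, so the vertices whose block contains
      \<open>p\<close> are the neighbours of \<open>p\<close>; injectivity of \<open>?N\<close>
      transfers the count to blocks.\<close>
    have "{v \<in> pverts ?G. p \<in> ?N v} = {A. A \<subseteq> {..<m} - p \<and> card A = k}"
      using p by (auto simp: neighbourhood_def kneser_graph_def)
    then have "{b \<in> ?N ` pverts ?G. p \<in> b} = ?N ` {A. A \<subseteq> {..<m} - p \<and> card A = k}"
      by blast
    moreover have "inj_on ?N {A. A \<subseteq> {..<m} - p \<and> card A = k}"
      by (rule inj_on_subset[OF inj_on_neighbourhood_kneser[OF assms]])
        (auto simp: mem_pverts_kneser)
    ultimately show ?thesis
      using card_nbhd[OF p] by (simp add: card_image)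
  qed
  ultimately show ?thesis
    using fin card_verts card_image[OF inj_on_neighbourhood_kneser[OF assms]]
    by (simp add: configuration_of_type_def is_incidence_structure_def V_construction_def
        subset_iff cong: conj_cong)
qed

lemma isometric_point_circle_V_construction_kneser:
  assumes "0 < k"
  shows "isometric_point_circle_configuration (V_construction (kneser_graph (2 * k + 1) k))"
proof -
  define m where "m = 2 * k + 1"
  let ?G = "kneser_graph m k"
  let ?N = "neighbourhood ?G"
  have km: "2 * k \<le> m"
    by (simp add: m_def)
  note U = Union_neighbourhood_kneser[OF assms km]
  obtain u :: "nat \<Rightarrow> real ^ 2" where norm_u: "\<And>i. i < m \<Longrightarrow> norm (u i) = 1"
    and inj_u: "inj_on (\<lambda>X. \<Sum>i\<in>X. u i) (Pow {..<m})"
    using exists_unit_vectors_distinct_subset_sums[of m] by blast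
  define pt where "pt X = (\<Sum>i\<in>X. u i)" for X
  \<comment> \<open>For \<open>b = ?N v\<close> the union is the complement of \<open>v\<close>, so
    no representative \<open>v\<close> has to be chosen.\<close>
  define circ where "circ b = sphere (pt (\<Union>b)) 1" for b
  have inj_pt: "inj_on pt (Pow {..<m})"
    using inj_u by (simp add: pt_def[abs_def])
  have "inj_on pt (pverts ?G)"
    by (rule inj_on_subset[OF inj_pt]) (auto simp: mem_pverts_kneser)
  moreover have "inj_on circ (?N ` pverts ?G)"
  proof (rule inj_onI)
    fix b c assume b: "b \<in> ?N ` pverts ?G" and c: "c \<in> ?N ` pverts ?G" and "circ b = circ c"
    then have "pt (\<Union>b) = pt (\<Union>c)"
      unfolding circ_def by (intro sphere_eq_sphereD) auto
    then have "\<Union>b = \<Union>c"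
      using inj_onD[OF inj_pt] Union_block_kneser_subset[OF b] Union_block_kneser_subset[OF c]
      by simp
    then show "b = c"
      using inj_onD[OF inj_on_Union_blocks_kneser[OF assms km]] b c by blast
  qed
  moreover have "pt p \<in> circ (?N v)"
    if p: "p \<in> pverts ?G" and v: "v \<in> pverts ?G" and inc: "p \<in> ?N v" for p v
  proof -
    have sub: "p \<subseteq> {..<m} - v"
      using v inc by (simp add: neighbourhood_kneser)
    \<comment> \<open>The complement of \<open>v\<close> has \<open>k + 1\<close> elements,
      \<open>k\<close> of which form \<open>p\<close>.\<close>
    have "card ({..<m} - v - p) = 1"
      using sub p card_complement_kneser[OF v]
      by (subst card_Diff_subset) (auto simp: mem_pverts_kneser m_def finite_subset)
    then obtain i where "{..<m} - v - p = {i}"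
      by (auto simp: card_1_singleton_iff)
    then have i: "{..<m} - v = insert i p" "i \<notin> p" "i < m"
      using sub by auto
    have "finite p"
      using sub finite_subset by blast
    then have "pt (\<Union>(?N v)) = u i + pt p"
      using i by (simp add: U[OF v] pt_def)
    then show ?thesis
      using norm_u[OF i(3)] by (simp add: circ_def dist_norm)
  qed
  ultimately have "isometric_point_circle_realization (V_construction ?G) pt circ"
    unfolding isometric_point_circle_realization_def V_construction_def
    by (auto simp: circ_def intro!: exI[of _ "1::real"])
  then show ?thesis
    unfolding isometric_point_circle_configuration_def m_def by blast
qed

section \<open>Indicator vectors\<close>

text \<open>The restriction gives the value \<open>undefined\<close> outside \<open>{..<d}\<close>,
  as membership in \<open>binary_vectors\<close> demands.\<close>

definition indicator_vector :: "nat \<Rightarrow> nat set \<Rightarrow> nat \<Rightarrow> nat" where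
  "indicator_vector d X = (\<lambda>i\<in>{..<d}. if i \<in> X then 1 else 0)"

lemma indicator_vector_in_binary_vectors: "indicator_vector d X \<in> binary_vectors d"
  by (simp add: indicator_vector_def binary_vectors_def)

lemma support_indicator_vector:
  "X \<subseteq> {..<d} \<Longrightarrow> {i \<in> {..<d}. indicator_vector d X i = 1} = X"
  by (auto simp: indicator_vector_def)

lemma inj_on_indicator_vector: "inj_on (indicator_vector d) (Pow {..<d})"
  by (rule inj_onI) (metis PowD support_indicator_vector)

lemma indicator_vectors_differ:
  "X \<subseteq> {..<d} \<Longrightarrow> Y \<subseteq> {..<d} \<Longrightarrow>
    {i \<in> {..<d}. indicator_vector d X i \<noteq> indicator_vector d Y i} = (X - Y) \<union> (Y - X)"
  by (auto simp: indicator_vector_def)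

lemma V_construction_kneser_in_clifford:
  assumes "0 < k" and d: "d = 2 * k + 1"
  shows "\<exists>S. subconfiguration S (clifford_configuration d) \<and>
    isomorphic_incidence_structures (V_construction (kneser_graph d k)) S"
proof -
  let ?G = "kneser_graph d k"
  let ?N = "neighbourhood ?G"
  let ?C = "clifford_configuration d"
  have kd: "2 * k \<le> d"
    by (simp add: d)
  note U = Union_neighbourhood_kneser[OF assms(1) kd]
  \<comment> \<open>Points come from sets of size \<open>k\<close> and blocks from sets of size
    \<open>k + 1\<close>, but the Clifford points need even weight. Since \<open>d\<close> is odd,
    complementation swaps the parities when \<open>k\<close> is odd.\<close>
  define flip where "flip X = (if even k then X else {..<d} - X)" for X
  define f where "f X = indicator_vector d (flip X)" for X
  \<comment> \<open>\<open>S\<close> takes the induced incidence; that it agrees with membership in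
    the blocks is the content of \<open>inc\<close> below.\<close>
  define S where "S = \<lparr> points = f ` pverts ?G, blocks = (\<lambda>b. f (\<Union>b)) ` ?N ` pverts ?G,
    incidence = incidence ?C \<inter> (f ` pverts ?G \<times> (\<lambda>b. f (\<Union>b)) ` ?N ` pverts ?G) \<rparr>"
  have flip_sub: "flip X \<subseteq> {..<d}" if "X \<subseteq> {..<d}" for X
    using that by (auto simp: flip_def)
  have "inj_on flip (Pow {..<d})"
    by (rule inj_onI) (auto simp: flip_def split: if_splits)
  then have inj_f: "X = Y" if "f X = f Y" "X \<subseteq> {..<d}" "Y \<subseteq> {..<d}" for X Y
    using that flip_sub inj_onD[OF inj_on_indicator_vector] inj_onD[of flip "Pow {..<d}"]
    unfolding f_def by (metis PowI)
  have card_flip: "card (flip X) = (if even k then card X else d - card X)"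
    if "X \<subseteq> {..<d}" for X
    using that by (simp add: flip_def card_Diff_subset finite_subset)
  have point: "f p \<in> points ?C" if "p \<in> pverts ?G" for p
    using that flip_sub[of p] card_flip[of p]
    by (auto simp: clifford_configuration_def f_def indicator_vector_in_binary_vectors
        support_indicator_vector[simplified] mem_pverts_kneser d)
  have block: "f ({..<d} - v) \<in> blocks ?C" if "v \<in> pverts ?G" for v
    using card_complement_kneser[OF that] flip_sub[of "{..<d} - v"] card_flip[of "{..<d} - v"]
    by (auto simp: clifford_configuration_def f_def indicator_vector_in_binary_vectors
        support_indicator_vector[simplified] d)
  have inc: "(f p, f ({..<d} - v)) \<in> incidence ?C \<longleftrightarrow> p \<in> ?N v"
    if p: "p \<in> pverts ?G" and v: "v \<in> pverts ?G" for p v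
  proof -
    let ?Y = "{..<d} - v"
    have p': "p \<subseteq> {..<d}" "card p = k"
      using p by (auto simp: mem_pverts_kneser)
    have "(f p, f ?Y) \<in> incidence ?C \<longleftrightarrow> card {i \<in> {..<d}. f p i \<noteq> f ?Y i} = 1"
      using point[OF p] block[OF v] by (simp add: clifford_configuration_def Let_def)
    also have "{i \<in> {..<d}. f p i \<noteq> f ?Y i} = (flip p - flip ?Y) \<union> (flip ?Y - flip p)"
      unfolding f_def using p' flip_sub by (intro indicator_vectors_differ) auto
    \<comment> \<open>Complementing both sets preserves their symmetric difference.\<close>
    also have "\<dots> = (p - ?Y) \<union> (?Y - p)"
      using p' by (auto simp: flip_def)
    also have "card \<dots> = 1 \<longleftrightarrow> p \<subseteq> ?Y"
      using p' card_complement_kneser[OF v]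
      by (intro card_symdiff_eq_1_iff) (auto simp: d finite_subset)
    finally show ?thesis
      using v p' by (simp add: neighbourhood_kneser)
  qed
  have "subconfiguration S ?C"
    using point block by (auto simp: subconfiguration_def S_def U)
  moreover have "isomorphic_incidence_structures (V_construction ?G) S"
    unfolding isomorphic_incidence_structures_def
  proof (intro exI conjI ballI)
    show "bij_betw f (points (V_construction ?G)) (points S)"
      by (auto simp: bij_betw_def S_def V_construction_def mem_pverts_kneser
          intro!: inj_onI dest: inj_f)
    have "inj_on (\<lambda>b. f (\<Union>b)) (?N ` pverts ?G)"
    proof (rule inj_onI)
      fix b c assume b: "b \<in> ?N ` pverts ?G" and c: "c \<in> ?N ` pverts ?G"
        and "f (\<Union>b) = f (\<Union>c)"
      then have "\<Union>b = \<Union>c"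
        using inj_f Union_block_kneser_subset[OF b] Union_block_kneser_subset[OF c] by blast
      then show "b = c"
        using inj_onD[OF inj_on_Union_blocks_kneser[OF assms(1) kd]] b c by blast
    qed
    then show "bij_betw (\<lambda>b. f (\<Union>b)) (blocks (V_construction ?G)) (blocks S)"
      by (simp add: bij_betw_def S_def V_construction_def)
    fix p b assume "p \<in> points (V_construction ?G)" "b \<in> blocks (V_construction ?G)"
    then show "((p, b) \<in> incidence (V_construction ?G)) = ((f p, f (\<Union>b)) \<in> incidence S)"
      by (auto simp: V_construction_def S_def U inc)
  qed
  ultimately show ?thesis
    by blast
qed

theorem theorem5p2:
  fixes n :: nat
  assumes "n \<ge> 3"
  shows "\<exists>C. configuration_of_type C ((2 * n - 1) choose (n - 1)) n \<and>
    isometric_point_circle_configuration C \<and>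
    (\<exists>S. subconfiguration S (clifford_configuration (2 * n - 1)) \<and>
         isomorphic_incidence_structures C S) \<and>
    C = V_construction (odd_graph n)"
proof -
  obtain k where k: "n = Suc k" "0 < k"
    using assms by (cases n) auto
  have "configuration_of_type (V_construction (odd_graph n)) ((2 * n - 1) choose (n - 1)) n"
    \<comment> \<open>Here \<open>m - k = k + 1\<close>, so the degree is
      \<open>Suc k choose k\<close>, which equals \<open>n\<close>.\<close>
    using configuration_V_construction_kneser[of k "2 * k + 1"] k
    by (simp add: odd_graph_def)
  then show ?thesis
    using isometric_point_circle_V_construction_kneser[of k]
      V_construction_kneser_in_clifford[of k "2 * n - 1"] k
    by (simp add: odd_graph_def)
qed

end
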